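(* Let $(a_i)_{i\ge1}$ and $(b_i)_{i\ge 1}$ be any two sequences of integers with $a_1=b_1$. Then there is a unique semi-infinite chessboard $(x_{ij})_{i,j\ge1}$ with integer entries satisfying the neighbor-sum property such that $x_{1i}=a_i$ and $x_{i1}=b_i$ for all $i\ge 1$.
   Context: A semi-infinite chessboard is an assignment of an integer $x_{ij}$ to each square $(i,j)\in\mathbb{N}\times\mathbb{N}$, $\mathbb{N}=\{1,2,\ldots\}$. Two distinct squares $(i,j)\ne(i',j')$ are neighbors if $|i-i'|\le1$ and $|j-j'|\le1$. The board satisfies the neighbor-sum property if the number on each square equals the sum of the numbers on all its neighboring squares. *)

theory Defs
  imports Main "HOL-Library.FuncSet"
begin

definition squares :: "(nat \<times> nat) set" where
  "squares = {1..} \<times> {1..}"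

definition neighbor :: "nat \<times> nat \<Rightarrow> nat \<times> nat \<Rightarrow> bool" where
  "neighbor p q \<longleftrightarrow> p \<noteq> q \<and>
     \<bar>int (fst p) - int (fst q)\<bar> \<le> 1 \<and> \<bar>int (snd p) - int (snd q)\<bar> \<le> 1"

text \<open>A board is a function on \<open>squares\<close>. The extensional function space fixes its
  irrelevant values off \<open>squares\<close>, so that equality of boards is equality on all squares.\<close>

definition chessboards :: "(nat \<times> nat \<Rightarrow> int) set" where
  "chessboards = squares \<rightarrow>\<^sub>E UNIV"

definition neighbor_sum_property :: "(nat \<times> nat \<Rightarrow> int) \<Rightarrow> bool" where
  "neighbor_sum_property x \<longleftrightarrow>
     (\<forall>p \<in> squares. x p = (\<Sum>q | q \<in> squares \<and> neighbor p q. x q))"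

lemma finite_neighbors: "finite {q. q \<in> squares \<and> neighbor p q}"
proof (rule finite_subset)
  show "{q. q \<in> squares \<and> neighbor p q} \<subseteq> {..Suc (fst p)} \<times> {..Suc (snd p)}"
    by (auto simp: neighbor_def)
qed simp

end

(* Solving the neighbor-sum equation at (i,j) for the lower right neighbor gives
   x(i+1,j+1) = x(i,j) - (sum of the other seven neighbors), and those seven precede (i+1,j+1)
   in the lexicographic order. So the entries off the first row and column are
   determined, one row at a time from left to right, by the first row and column.
   Padding the board by zeros in row 0 and column 0 removes the boundary cases. *)

theory Submission
  imports Defs
begin

definition padded :: "(nat \<times> nat \<Rightarrow> int) \<Rightarrow> nat \<Rightarrow> nat \<Rightarrow> int" where
  "padded x i j = (if (i, j) \<in> squares then x (i, j) else 0)"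

lemma padded_simps [simp]:
  "padded x 0 j = 0" "padded x i 0 = 0" "padded x (Suc i) (Suc j) = x (Suc i, Suc j)"
  by (simp_all add: padded_def squares_def)

text \<open>Of the eight positions around a square, those that are not squares lie in row or column
  0, where \<open>padded\<close> vanishes. One formula thus covers interior, edge and corner
  squares.\<close>

lemma sum_neighbors_padded:
  "(\<Sum>q | q \<in> squares \<and> neighbor (Suc i, Suc j) q. x q) =
     padded x i j + padded x i (Suc j) + padded x i (Suc (Suc j))
     + padded x (Suc i) j + padded x (Suc i) (Suc (Suc j))
     + padded x (Suc (Suc i)) j + padded x (Suc (Suc i)) (Suc j)
     + padded x (Suc (Suc i)) (Suc (Suc j))"
proof -
  let ?S = "{q. q \<in> squares \<and> neighbor (Suc i, Suc j) q}"
  let ?N = "{(i, j), (i, Suc j), (i, Suc (Suc j)), (Suc i, j), (Suc i, Suc (Suc j)),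
             (Suc (Suc i), j), (Suc (Suc i), Suc j), (Suc (Suc i), Suc (Suc j))}"
  have sub: "?S \<subseteq> ?N"
  proof
    fix q assume "q \<in> ?S"
    then obtain k l where q: "q = (k, l)" and "Suc i \<noteq> k \<or> Suc j \<noteq> l"
      and "\<bar>int (Suc i) - int k\<bar> \<le> 1" "\<bar>int (Suc j) - int l\<bar> \<le> 1"
      by (cases q) (simp add: neighbor_def)
    moreover have "k = i \<or> k = Suc i \<or> k = Suc (Suc i)" "l = j \<or> l = Suc j \<or> l = Suc (Suc j)"
      using calculation by linarith+
    ultimately show "q \<in> ?N"
      by blast
  qed
  have "sum x ?S = (\<Sum>q\<in>?S. padded x (fst q) (snd q))"
    by (rule sum.cong) (auto simp: padded_def)
  also have "\<dots> = (\<Sum>q\<in>?N. padded x (fst q) (snd q))"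
  proof (rule sum.mono_neutral_left)
    show "\<forall>q\<in>?N - ?S. padded x (fst q) (snd q) = 0"
      by (auto simp: padded_def neighbor_def)
    show "?S \<subseteq> ?N"
      by (rule sub)
  qed simp
  finally show ?thesis
    by (simp add: add.assoc)
qed

lemma neighbor_sum_property_iff:
  "neighbor_sum_property x \<longleftrightarrow>
   (\<forall>i j. padded x (Suc (Suc i)) (Suc (Suc j)) =
     padded x (Suc i) (Suc j) - padded x i j - padded x i (Suc j) - padded x i (Suc (Suc j))
     - padded x (Suc i) j - padded x (Suc i) (Suc (Suc j))
     - padded x (Suc (Suc i)) j - padded x (Suc (Suc i)) (Suc j))"
  (is "_ \<longleftrightarrow> ?rhs")
proof -
  have "neighbor_sum_property x \<longleftrightarrow> (\<forall>i j. x (Suc i, Suc j) =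
          (\<Sum>q | q \<in> squares \<and> neighbor (Suc i, Suc j) q. x q))"
    unfolding neighbor_sum_property_def squares_def
    by (auto simp: Suc_le_eq gr0_conv_Suc)
  also have "\<dots> \<longleftrightarrow> ?rhs"
    \<comment> \<open>Folding the entries back into \<open>padded\<close> leaves two linear
      equations over the same nine terms.\<close>
    unfolding sum_neighbors_padded padded_simps(3)[symmetric]
    by (intro all_cong1) linarith
  finally show ?thesis .
qed

context
  fixes a b :: "nat \<Rightarrow> int"
begin

text \<open>The corner gets its value from \<open>a\<close>; \<open>b\<close> enters only from row 2
  on. Row and column 0 carry the zero padding, so the last equation has the form of
  \<open>neighbor_sum_property_iff\<close>.\<close>

fun board :: "nat \<Rightarrow> nat \<Rightarrow> int" where
  "board 0 j = 0"
| "board (Suc i) 0 = 0"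
| "board (Suc 0) (Suc j) = a (Suc j)"
| "board (Suc (Suc i)) (Suc 0) = b (Suc (Suc i))"
| "board (Suc (Suc i)) (Suc (Suc j)) =
     board (Suc i) (Suc j) - board i j - board i (Suc j) - board i (Suc (Suc j))
     - board (Suc i) j - board (Suc i) (Suc (Suc j))
     - board (Suc (Suc i)) j - board (Suc (Suc i)) (Suc j)"

lemma board_0_right [simp]: "board i 0 = 0"
  by (cases i) auto

text \<open>This is the uniqueness half. Induction along the recursion of \<open>board\<close>: the
  first four equations are padding or boundary data, and the fifth is the solved neighbor-sum
  equation.\<close>

lemma padded_eq_board:
  assumes "neighbor_sum_property x" and "\<forall>i\<ge>1. x (1, i) = a i \<and> x (i, 1) = b i"
  shows "padded x i j = board i j"
proof (induction i j rule: board.induct)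
  case (5 i j)
  then show ?case
    using assms(1) unfolding neighbor_sum_property_iff by (simp del: padded_simps(3))
qed (use assms(2) in auto)

end

theorem mainTheorem8:
  fixes a b :: "nat \<Rightarrow> int"
  assumes "a 1 = b 1"
  shows "\<exists>!x. x \<in> chessboards \<and> neighbor_sum_property x \<and>
           (\<forall>i\<ge>1. x (1, i) = a i \<and> x (i, 1) = b i)"
proof (rule ex1I)
  define x where "x = restrict (\<lambda>(i, j). board a b i j) squares"
  \<comment> \<open>Since \<open>board\<close> is zero in row and column 0, this holds for all
    indices, and the neighbor-sum property of \<open>x\<close> becomes the last equation of
    \<open>board\<close>.\<close>
  have x_board: "padded x i j = board a b i j" for i j
    by (cases i; cases j) (auto simp: x_def squares_def)
  have "x (1, i) = a i \<and> x (i, 1) = b i" if "i \<ge> 1" for i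
  \<comment> \<open>At the corner \<open>board\<close> gives \<open>a 1\<close>, which must also be
    \<open>b 1\<close>: here the assumption enters.\<close>
  proof (cases "i = 1")
    case False
    with that obtain k where "i = Suc (Suc k)"
      by (metis One_nat_def Suc_le_D not0_implies_Suc)
    then show ?thesis
      by (simp add: x_def squares_def)
  qed (use assms in \<open>simp add: x_def squares_def\<close>)
  moreover have "neighbor_sum_property x"
    unfolding neighbor_sum_property_iff x_board by simp
  moreover have "x \<in> chessboards"
    by (simp add: x_def chessboards_def)
  ultimately show "x \<in> chessboards \<and> neighbor_sum_property x \<and>
      (\<forall>i\<ge>1. x (1, i) = a i \<and> x (i, 1) = b i)"
    by blast
  fix y
  assume y: "y \<in> chessboards \<and> neighbor_sum_property y \<and>
      (\<forall>i\<ge>1. y (1, i) = a i \<and> y (i, 1) = b i)"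
  show "y = x"
  proof (rule PiE_ext)
    show "y \<in> squares \<rightarrow>\<^sub>E UNIV" "x \<in> squares \<rightarrow>\<^sub>E UNIV"
      using y \<open>x \<in> chessboards\<close> by (auto simp: chessboards_def)
    fix p assume "p \<in> squares"
    \<comment> \<open>Both sides equal \<open>board a b\<close>, the left by uniqueness and the
      right by construction.\<close>
    moreover have "padded y (fst p) (snd p) = padded x (fst p) (snd p)"
      using y by (simp add: x_board padded_eq_board)
    ultimately show "y p = x p"
      by (simp add: padded_def)
  qed
qed

end
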